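(* The axiomatization consisting of A1-4, WIF1, WIF2$'$, W1$'$ and CT1$'$ is sound, ground-complete and $\omega$-complete for BCCS($A$) modulo $\precsim_{\rm WCT}$.
   Context: $A$ is a nonempty countable set of actions, $\tau\notin A$, $A_\tau=A\cup\{\tau\}$. BCCS($A$) terms: $t::=0\mid x\mid\alpha t\mid t+t$ ($x$ a variable, $\alpha\in A_\tau$). Transitions: $\alpha t\xrightarrow{\alpha}t$; if $t\xrightarrow{\alpha}t'$ then $t+u\xrightarrow{\alpha}t'$ and $u+t\xrightarrow{\alpha}t'$. $\Rightarrow$ is the reflexive-transitive closure of $\xrightarrow{\tau}$; $\mathcal{I}(s)=\{\alpha\mid s\xrightarrow{\alpha}\}$. $a_1\cdots a_k\in A^*$ is a weak completed trace of closed $s$ if $s\Rightarrow\xrightarrow{a_1}\Rightarrow\cdots\xrightarrow{a_k}\Rightarrow s'$ with $\mathcal{I}(s')=\emptyset$; $\mathcal{WCT}(s)$ the set. $s_1\precsim_{\rm WCT}s_2$ iff $\mathcal{WCT}(s_1)\subseteq\mathcal{WCT}(s_2)$ and $s_1\xrightarrow{\tau}$ implies $s_2\xrightarrow{\tau}$; on open terms via all closed substitutions. Inequational logic (reflexivity, transitivity, substitution instances, closure under contexts; an equation abbreviates two inequations); sound, ground-complete (closed $p\precsim_{\rm WCT}q$ implies $p\preccurlyeq q$ derivable), $\omega$-complete (if all closed instances derivable then the inequation is). Axioms ($\alpha$ over $A_\tau$): A1: $x+y\approx y+x$; A2: $(x+y)+z\approx x+(y+z)$; A3: $x+x\approx x$;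 A4: $x+0\approx x$; WIF1: $\alpha(\tau x+\tau y)\approx\alpha x+\alpha y$; WIF2$'$: $\tau(x+y)\preccurlyeq\tau x+y$; W1$'$: $x\preccurlyeq\tau x+y$; CT1$'$: $\alpha x\preccurlyeq\alpha x+y$. *)

theory Defs
  imports Main "HOL-Library.Countable"
begin

text \<open>
  The set \<open>A\<close> of actions is the (nonempty) universe of the type variable \<open>'a\<close>, which is
  constrained to class \<open>countable\<close> in the theorem; \<open>'a act\<close> is \<open>A\<close> together with a fresh \<open>\<tau>\<close>.
  The countably infinite set of variables is \<open>nat\<close>.
\<close>

datatype 'a act = Tau ("\<tau>") | Act 'a

datatype 'a trm =
    Zero ("\<zero>")
  | Var nat
  | Prefix "'a act" "'a trm" (infixr "\<cdot>" 80)
  | Sum "'a trm" "'a trm" (infixl "\<oplus>" 65)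

primrec vars :: "'a trm \<Rightarrow> nat set" where
  "vars \<zero> = {}"
| "vars (Var x) = {x}"
| "vars (\<alpha> \<cdot> t) = vars t"
| "vars (t \<oplus> u) = vars t \<union> vars u"

definition closed_trm :: "'a trm \<Rightarrow> bool" where
  "closed_trm t \<longleftrightarrow> vars t = {}"

primrec subst :: "(nat \<Rightarrow> 'a trm) \<Rightarrow> 'a trm \<Rightarrow> 'a trm" where
  "subst \<sigma> \<zero> = \<zero>"
| "subst \<sigma> (Var x) = \<sigma> x"
| "subst \<sigma> (\<alpha> \<cdot> t) = \<alpha> \<cdot> subst \<sigma> t"
| "subst \<sigma> (t \<oplus> u) = subst \<sigma> t \<oplus> subst \<sigma> u"

definition closed_subst :: "(nat \<Rightarrow> 'a trm) \<Rightarrow> bool" where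
  "closed_subst \<sigma> \<longleftrightarrow> (\<forall>x. closed_trm (\<sigma> x))"

inductive step :: "'a trm \<Rightarrow> 'a act \<Rightarrow> 'a trm \<Rightarrow> bool" where
  step_prefix: "step (\<alpha> \<cdot> t) \<alpha> t"
| step_sum_left: "step t \<alpha> t' \<Longrightarrow> step (t \<oplus> u) \<alpha> t'"
| step_sum_right: "step t \<alpha> t' \<Longrightarrow> step (u \<oplus> t) \<alpha> t'"

definition initials :: "'a trm \<Rightarrow> 'a act set" where
  "initials s = {\<alpha>. \<exists>s'. step s \<alpha> s'}"

definition tau_steps :: "'a trm \<Rightarrow> 'a trm \<Rightarrow> bool" where
  "tau_steps = (\<lambda>s s'. step s \<tau> s')\<^sup>*\<^sup>*"

primrec weak_steps :: "'a list \<Rightarrow> 'a trm \<Rightarrow> 'a trm \<Rightarrow> bool" where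
  "weak_steps [] s s' \<longleftrightarrow> tau_steps s s'"
| "weak_steps (a # w) s s' \<longleftrightarrow>
     (\<exists>s1 s2. tau_steps s s1 \<and> step s1 (Act a) s2 \<and> weak_steps w s2 s')"

definition WCT :: "'a trm \<Rightarrow> 'a list set" where
  "WCT s = {w. \<exists>s'. weak_steps w s s' \<and> initials s' = {}}"

text \<open>\<open>WCT\<close> and \<open>wct_le_closed\<close> are meaningful on closed terms only.\<close>

definition wct_le_closed :: "'a trm \<Rightarrow> 'a trm \<Rightarrow> bool" where
  "wct_le_closed s1 s2 \<longleftrightarrow> WCT s1 \<subseteq> WCT s2 \<and> (\<tau> \<in> initials s1 \<longrightarrow> \<tau> \<in> initials s2)"

definition wct_le :: "'a trm \<Rightarrow> 'a trm \<Rightarrow> bool" (infix "\<lesssim>\<^sub>W\<^sub>C\<^sub>T" 50) where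
  "t \<lesssim>\<^sub>W\<^sub>C\<^sub>T u \<longleftrightarrow> (\<forall>\<sigma>. closed_subst \<sigma> \<longrightarrow> wct_le_closed (subst \<sigma> t) (subst \<sigma> u))"

lemma subst_closed_trm: "closed_trm t \<Longrightarrow> subst \<sigma> t = t"
  by (induction t) (auto simp: closed_trm_def)

lemma wct_le_iff_closed:
  assumes "closed_trm p" and "closed_trm q"
  shows "p \<lesssim>\<^sub>W\<^sub>C\<^sub>T q \<longleftrightarrow> wct_le_closed p q"
proof -
  have "closed_subst (\<lambda>_. \<zero>)"
    by (simp add: closed_subst_def closed_trm_def)
  then show ?thesis
    using assms by (auto simp: wct_le_def subst_closed_trm)
qed

type_synonym 'a ineq = "'a trm \<times> 'a trm"

inductive derivable :: "'a ineq set \<Rightarrow> 'a trm \<Rightarrow> 'a trm \<Rightarrow> bool" ("_ \<turnstile> _ \<preceq> _" [51, 51, 51] 50)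
  for E :: "'a ineq set" where
  ax: "(t, u) \<in> E \<Longrightarrow> E \<turnstile> t \<preceq> u"
| refl: "E \<turnstile> t \<preceq> t"
| trans: "E \<turnstile> t \<preceq> u \<Longrightarrow> E \<turnstile> u \<preceq> v \<Longrightarrow> E \<turnstile> t \<preceq> v"
| instance_of: "E \<turnstile> t \<preceq> u \<Longrightarrow> E \<turnstile> subst \<sigma> t \<preceq> subst \<sigma> u"
| prefix: "E \<turnstile> t \<preceq> u \<Longrightarrow> E \<turnstile> \<alpha> \<cdot> t \<preceq> \<alpha> \<cdot> u"
| sum_left: "E \<turnstile> t \<preceq> u \<Longrightarrow> E \<turnstile> t \<oplus> v \<preceq> u \<oplus> v"
| sum_right: "E \<turnstile> t \<preceq> u \<Longrightarrow> E \<turnstile> v \<oplus> t \<preceq> v \<oplus> u"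

definition sound :: "'a ineq set \<Rightarrow> ('a trm \<Rightarrow> 'a trm \<Rightarrow> bool) \<Rightarrow> bool" where
  "sound E R \<longleftrightarrow> (\<forall>t u. E \<turnstile> t \<preceq> u \<longrightarrow> R t u)"

definition ground_complete :: "'a ineq set \<Rightarrow> ('a trm \<Rightarrow> 'a trm \<Rightarrow> bool) \<Rightarrow> bool" where
  "ground_complete E R \<longleftrightarrow>
     (\<forall>p q. closed_trm p \<longrightarrow> closed_trm q \<longrightarrow> R p q \<longrightarrow> E \<turnstile> p \<preceq> q)"

definition omega_complete :: "'a ineq set \<Rightarrow> bool" where
  "omega_complete E \<longleftrightarrow>
     (\<forall>t u. (\<forall>\<sigma>. closed_subst \<sigma> \<longrightarrow> E \<turnstile> subst \<sigma> t \<preceq> subst \<sigma> u) \<longrightarrow> E \<turnstile> t \<preceq> u)"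

definition equation :: "'a trm \<Rightarrow> 'a trm \<Rightarrow> 'a ineq set" where
  "equation t u = {(t, u), (u, t)}"

abbreviation x\<^sub>0 :: "'a trm" where "x\<^sub>0 \<equiv> Var 0"
abbreviation y\<^sub>0 :: "'a trm" where "y\<^sub>0 \<equiv> Var 1"
abbreviation z\<^sub>0 :: "'a trm" where "z\<^sub>0 \<equiv> Var 2"

definition A1 :: "'a ineq set" where
  "A1 = equation (x\<^sub>0 \<oplus> y\<^sub>0) (y\<^sub>0 \<oplus> x\<^sub>0)"

definition A2 :: "'a ineq set" where
  "A2 = equation ((x\<^sub>0 \<oplus> y\<^sub>0) \<oplus> z\<^sub>0) (x\<^sub>0 \<oplus> (y\<^sub>0 \<oplus> z\<^sub>0))"

definition A3 :: "'a ineq set" where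
  "A3 = equation (x\<^sub>0 \<oplus> x\<^sub>0) x\<^sub>0"

definition A4 :: "'a ineq set" where
  "A4 = equation (x\<^sub>0 \<oplus> \<zero>) x\<^sub>0"

definition WIF1 :: "'a ineq set" where
  "WIF1 = (\<Union>\<alpha>. equation (\<alpha> \<cdot> (\<tau> \<cdot> x\<^sub>0 \<oplus> \<tau> \<cdot> y\<^sub>0)) (\<alpha> \<cdot> x\<^sub>0 \<oplus> \<alpha> \<cdot> y\<^sub>0))"

definition WIF2' :: "'a ineq set" where
  "WIF2' = {(\<tau> \<cdot> (x\<^sub>0 \<oplus> y\<^sub>0), \<tau> \<cdot> x\<^sub>0 \<oplus> y\<^sub>0)}"

definition W1' :: "'a ineq set" where
  "W1' = {(x\<^sub>0, \<tau> \<cdot> x\<^sub>0 \<oplus> y\<^sub>0)}"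

definition CT1' :: "'a ineq set" where
  "CT1' = (\<Union>\<alpha>. {(\<alpha> \<cdot> x\<^sub>0, \<alpha> \<cdot> x\<^sub>0 \<oplus> y\<^sub>0)})"

definition WCT_axioms :: "'a ineq set" where
  "WCT_axioms = A1 \<union> A2 \<union> A3 \<union> A4 \<union> WIF1 \<union> WIF2' \<union> W1' \<union> CT1'"

end

theory Submission
  imports Defs
begin

text \<open>
  The weak completed traces of a closed instance of an open term \<open>t\<close> are determined by which
  variables \<open>t\<close> can weakly reach by which words, and by which words lead \<open>t\<close> to a mere sum of
  variables. Substituting long enough action sequences or \<open>\<zero>\<close> for the variables, one
  reads off from a valid inequation \<open>t \<lesssim> u\<close> that \<open>u\<close> matches every variable occurrence of \<open>t\<close>, and
  every stuck state of \<open>t\<close> by a stuck state with fewer variables. Conversely these matching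
  conditions suffice for a derivation: CT1' makes sums of prefixed terms behave as joins, so by WIF1
  and W1' a prefixed term can be taken apart and its components bounded by \<open>u\<close> one by one.
  Hence every inequation valid for all closed instances is derivable, which gives ground-completeness
  and \<open>\<omega>\<close>-completeness at once.
\<close>

section \<open>Weak transitions and completed traces\<close>

lemma step_simps [simp]:
  "\<not> step \<zero> \<alpha> t'"
  "\<not> step (Var x) \<alpha> t'"
  "step (\<beta> \<cdot> t) \<alpha> t' \<longleftrightarrow> \<alpha> = \<beta> \<and> t' = t"
  "step (t \<oplus> u) \<alpha> t' \<longleftrightarrow> step t \<alpha> t' \<or> step u \<alpha> t'"
  by (auto elim: step.cases intro: step.intros)

lemma initials_simps [simp]:
  "initials \<zero> = {}"
  "initials (Var x) = {}"
  "initials (\<alpha> \<cdot> t) = {\<alpha>}"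
  "initials (t \<oplus> u) = initials t \<union> initials u"
  by (auto simp: initials_def)

lemma step_initials: "step t \<alpha> t' \<Longrightarrow> \<alpha> \<in> initials t"
  by (auto simp: initials_def)

lemma step_size: "step t \<alpha> t' \<Longrightarrow> size t' < size t"
  by (induction rule: step.induct) auto

lemma weak_steps_refl: "weak_steps [] t t"
  by (simp add: tau_steps_def)

lemma weak_steps_tau: "step t \<tau> t' \<Longrightarrow> weak_steps w t' t'' \<Longrightarrow> weak_steps w t t''"
  by (cases w) (auto simp: tau_steps_def intro: converse_rtranclp_into_rtranclp)

lemma weak_steps_act: "step t (Act a) t' \<Longrightarrow> weak_steps w t' t'' \<Longrightarrow> weak_steps (a # w) t t''"
  by (auto simp: tau_steps_def)

text \<open>The recursion of \<open>weak_steps\<close> splits off a whole block of silent steps at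
  each letter. This rule exposes one transition at a time, the form that the later inductions
  use.\<close>

lemma weak_steps_induct [consumes 1, case_names refl tau act]:
  assumes "weak_steps w t u"
    and refl: "\<And>t. P [] t t"
    and tau: "\<And>w t t' u. step t \<tau> t' \<Longrightarrow> weak_steps w t' u \<Longrightarrow> P w t' u \<Longrightarrow> P w t u"
    and act: "\<And>a w t t' u. step t (Act a) t' \<Longrightarrow> weak_steps w t' u \<Longrightarrow> P w t' u \<Longrightarrow> P (a # w) t u"
  shows "P w t u"
  using assms(1)
proof (induction w arbitrary: t)
  case Nil
  then have "(\<lambda>s s'. step s \<tau> s')\<^sup>*\<^sup>* t u"
    by (simp add: tau_steps_def)
  then show ?case
    by (induction rule: converse_rtranclp_induct)
      (auto intro: refl tau simp: tau_steps_def)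
next
  case (Cons a w)
  then obtain s1 s2 where *: "(\<lambda>s s'. step s \<tau> s')\<^sup>*\<^sup>* t s1" "step s1 (Act a) s2" "weak_steps w s2 u"
    by (auto simp: tau_steps_def)
  \<comment> \<open>The run itself is carried along because the premise \<open>tau\<close> asks for
    it.\<close>
  have "P (a # w) t u \<and> weak_steps (a # w) t u"
    using *(1)
    by (induction rule: converse_rtranclp_induct)
      (use * Cons.IH in \<open>blast intro: act tau weak_steps_act weak_steps_tau\<close>)+
  then show ?case ..
qed

lemma weak_steps_append:
  "weak_steps v t t' \<Longrightarrow> weak_steps w t' t'' \<Longrightarrow> weak_steps (v @ w) t t''"
  by (induction rule: weak_steps_induct) (auto intro: weak_steps_tau weak_steps_act simp del: weak_steps.simps)

lemma WCT_stop: "initials t = {} \<Longrightarrow> [] \<in> WCT t"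
  by (auto simp: WCT_def tau_steps_def)

lemma WCT_weak_steps: "weak_steps v t t' \<Longrightarrow> w \<in> WCT t' \<Longrightarrow> v @ w \<in> WCT t"
  by (auto simp: WCT_def dest: weak_steps_append)

lemma WCT_tau: "step t \<tau> t' \<Longrightarrow> w \<in> WCT t' \<Longrightarrow> w \<in> WCT t"
  by (auto simp: WCT_def dest: weak_steps_tau)

lemma WCT_act: "step t (Act a) t' \<Longrightarrow> w \<in> WCT t' \<Longrightarrow> a # w \<in> WCT t"
  by (auto simp: WCT_def simp del: weak_steps.simps dest: weak_steps_act)

lemma WCT_induct [consumes 1, case_names stop tau act]:
  assumes "w \<in> WCT t"
    and stop: "\<And>t. initials t = {} \<Longrightarrow> P [] t"
    and tau: "\<And>w t t'. step t \<tau> t' \<Longrightarrow> w \<in> WCT t' \<Longrightarrow> P w t' \<Longrightarrow> P w t"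
    and act: "\<And>a w t t'. step t (Act a) t' \<Longrightarrow> w \<in> WCT t' \<Longrightarrow> P w t' \<Longrightarrow> P (a # w) t"
  shows "P w t"
proof -
  obtain u where "weak_steps w t u" "initials u = {}"
    using assms(1) by (auto simp: WCT_def)
  then show ?thesis
  proof (induction rule: weak_steps_induct)
    case (tau w t t' u)
    then show ?case
      using assms(3) unfolding WCT_def by blast
  next
    case (act a w t t' u)
    then show ?case
      using assms(4) unfolding WCT_def by blast
  qed (rule stop)
qed

lemma WCT_cases [consumes 1, case_names stop tau act]:
  assumes "w \<in> WCT t"
  obtains "initials t = {}" "w = []"
  | t' where "step t \<tau> t'" "w \<in> WCT t'"
  | a v t' where "step t (Act a) t'" "w = a # v" "v \<in> WCT t'"
proof -
  have "(initials t = {} \<and> w = []) \<or> (\<exists>t'. step t \<tau> t' \<and> w \<in> WCT t')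
      \<or> (\<exists>a v t'. step t (Act a) t' \<and> w = a # v \<and> v \<in> WCT t')"
    using assms by (induction rule: WCT_induct) blast+
  then show thesis
    using that by blast
qed

text \<open>Every transition shrinks the term, so a run can always be continued until it ends in a
  stuck state.\<close>

lemma WCT_nonempty: "WCT t \<noteq> {}"
proof (induction t rule: measure_induct_rule [of size])
  case (less t)
  show ?case
  proof (cases "initials t = {}")
    case True
    then show ?thesis
      by (auto dest: WCT_stop)
  next
    case False
    then obtain \<alpha> t' where t': "step t \<alpha> t'"
      by (auto simp: initials_def)
    then obtain w where "w \<in> WCT t'"
      using less step_size by blast
    then show ?thesis
      using t' by (cases \<alpha>) (auto dest: WCT_tau WCT_act)
  qed
qed

lemma WCT_stuck: "initials t = {} \<Longrightarrow> WCT t = {[]}"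
  using WCT_stop by (blast elim: WCT_cases[of _ t] dest: step_initials)

lemma WCT_prefix_tau: "WCT (\<tau> \<cdot> t) = WCT t"
  by (auto elim!: WCT_cases[of _ "\<tau> \<cdot> t"] intro: WCT_tau)

lemma WCT_prefix_act: "WCT (Act a \<cdot> t) = (#) a ` WCT t"
  by (auto elim!: WCT_cases[of _ "Act a \<cdot> t"] intro: WCT_act)

lemma WCT_mono_steps:
  assumes "w \<in> WCT t" "initials t \<noteq> {}" "\<And>\<alpha> t'. step t \<alpha> t' \<Longrightarrow> step u \<alpha> t'"
  shows "w \<in> WCT u"
  using assms(1)
  by (cases rule: WCT_cases) (use assms in \<open>auto intro: WCT_tau WCT_act\<close>)

text \<open>A run of a sum starts with a step of one summand and is from then on a run of that
  summand. Only the empty run of a stuck summand is lost when the other summand can move.\<close>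

lemma WCT_sum:
  "WCT (t \<oplus> u) =
     (if initials t = {} then WCT u else if initials u = {} then WCT t else WCT t \<union> WCT u)"
proof (cases "initials t = {} \<and> initials u = {}")
  case True
  then show ?thesis
    by (simp add: WCT_stuck)
next
  case False
  have "(w \<in> WCT t \<and> initials t \<noteq> {}) \<or> (w \<in> WCT u \<and> initials u \<noteq> {})"
    if "w \<in> WCT (t \<oplus> u)" for w
    using that
    by (cases rule: WCT_cases) (use False in \<open>auto intro: WCT_tau WCT_act dest: step_initials\<close>)
  moreover have "w \<in> WCT (t \<oplus> u)" if "w \<in> WCT t" "initials t \<noteq> {}" for w
    using that by (auto intro: WCT_mono_steps)
  moreover have "w \<in> WCT (t \<oplus> u)" if "w \<in> WCT u" "initials u \<noteq> {}" for w
    using that by (auto intro: WCT_mono_steps)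
  ultimately have "WCT (t \<oplus> u)
      = {w \<in> WCT t. initials t \<noteq> {}} \<union> {w \<in> WCT u. initials u \<noteq> {}}"
    by blast
  then show ?thesis
    using False by auto
qed

section \<open>Soundness\<close>

text \<open>A stuck \<open>u\<close> has only the empty trace and no silent step. So
  \<open>t\<close> could move only by a visible action, and completing that run would give a
  nonempty trace. Closure under sums rests on this, as stuck summands are treated apart
  there.\<close>

lemma wct_le_closed_stuck:
  assumes "wct_le_closed t u" "initials u = {}"
  shows "initials t = {}"
proof (rule ccontr)
  assume "initials t \<noteq> {}"
  then obtain \<alpha> t' where t': "step t \<alpha> t'"
    by (auto simp: initials_def)
  then obtain a where "\<alpha> = Act a"
    using assms by (cases \<alpha>) (auto simp: wct_le_closed_def dest: step_initials)
  moreover obtain w where "w \<in> WCT t'"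
    using WCT_nonempty by blast
  ultimately have "a # w \<in> WCT t"
    using t' by (auto intro: WCT_act)
  then show False
    using assms by (auto simp: wct_le_closed_def WCT_stuck)
qed

lemma wct_le_closed_prefix: "wct_le_closed t u \<Longrightarrow> wct_le_closed (\<alpha> \<cdot> t) (\<alpha> \<cdot> u)"
  by (cases \<alpha>) (auto simp: wct_le_closed_def WCT_prefix_tau WCT_prefix_act)

lemma wct_le_closed_comm: "wct_le_closed (t \<oplus> u) (u \<oplus> t)"
  by (auto simp: wct_le_closed_def WCT_sum WCT_stuck)

lemma wct_le_closed_trans: "wct_le_closed t u \<Longrightarrow> wct_le_closed u v \<Longrightarrow> wct_le_closed t v"
  by (auto simp: wct_le_closed_def)

lemma wct_le_closed_sum_left:
  assumes "wct_le_closed t u"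
  shows "wct_le_closed (t \<oplus> v) (u \<oplus> v)"
proof (cases "initials v = {}")
  case True
  then have "WCT (s \<oplus> v) = WCT s" for s
    by (simp add: WCT_sum WCT_stuck)
  then show ?thesis
    using assms True by (simp add: wct_le_closed_def)
next
  case v: False
  show ?thesis
  proof (cases "initials t = {}")
    case True
    then show ?thesis
      using v by (auto simp: wct_le_closed_def WCT_sum)
  next
    case False
    then have "initials u \<noteq> {}"
      using assms wct_le_closed_stuck by blast
    then show ?thesis
      using assms v False by (auto simp: wct_le_closed_def WCT_sum)
  qed
qed

lemma wct_le_closed_sum_right: "wct_le_closed t u \<Longrightarrow> wct_le_closed (v \<oplus> t) (v \<oplus> u)"
  by (rule wct_le_closed_trans[OF wct_le_closed_comm
        wct_le_closed_trans[OF wct_le_closed_sum_left wct_le_closed_comm]])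

lemma subst_subst: "subst \<rho> (subst \<sigma> t) = subst (\<lambda>x. subst \<rho> (\<sigma> x)) t"
  by (induction t) auto

lemma closed_trm_subst: "closed_subst \<sigma> \<Longrightarrow> closed_trm (subst \<sigma> t)"
  by (induction t) (auto simp: closed_subst_def closed_trm_def)

text \<open>The rules for \<open>WCT\<close> treat a variable as a stuck term, so each axiom is
  checked once for arbitrary terms and \<open>\<sigma>\<close> may be any substitution.\<close>

lemma WCT_axioms_valid:
  assumes "(t, u) \<in> WCT_axioms"
  shows "wct_le_closed (subst \<sigma> t) (subst \<sigma> u)"
proof -
  have WIF1: "wct_le_closed (\<alpha> \<cdot> (\<tau> \<cdot> x \<oplus> \<tau> \<cdot> y)) (\<alpha> \<cdot> x \<oplus> \<alpha> \<cdot> y)"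
    "wct_le_closed (\<alpha> \<cdot> x \<oplus> \<alpha> \<cdot> y) (\<alpha> \<cdot> (\<tau> \<cdot> x \<oplus> \<tau> \<cdot> y))" for \<alpha> and x y :: "'a trm"
    by (cases \<alpha>; auto simp: wct_le_closed_def WCT_prefix_tau WCT_prefix_act WCT_sum)+
  have A2: "wct_le_closed ((x \<oplus> y) \<oplus> z) (x \<oplus> (y \<oplus> z))"
    "wct_le_closed (x \<oplus> (y \<oplus> z)) ((x \<oplus> y) \<oplus> z)" for x y z :: "'a trm"
    by (auto simp: wct_le_closed_def WCT_sum)
  have A3: "wct_le_closed (x \<oplus> x) x" "wct_le_closed x (x \<oplus> x)" for x :: "'a trm"
    by (auto simp: wct_le_closed_def WCT_sum)
  have A4: "wct_le_closed (x \<oplus> \<zero>) x" "wct_le_closed x (x \<oplus> \<zero>)" for x :: "'a trm"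
    by (auto simp: wct_le_closed_def WCT_sum WCT_stuck)
  have WIF2': "wct_le_closed (\<tau> \<cdot> (x \<oplus> y)) (\<tau> \<cdot> x \<oplus> y)" for x y :: "'a trm"
    by (auto simp: wct_le_closed_def WCT_sum WCT_prefix_tau WCT_stuck)
  have W1': "wct_le_closed x (\<tau> \<cdot> x \<oplus> y)" for x y :: "'a trm"
    by (auto simp: wct_le_closed_def WCT_sum WCT_prefix_tau)
  have CT1': "wct_le_closed (\<alpha> \<cdot> x) (\<alpha> \<cdot> x \<oplus> y)" for \<alpha> and x y :: "'a trm"
    by (auto simp: wct_le_closed_def WCT_sum)
  show ?thesis
    using assms
    unfolding WCT_axioms_def A1_def A2_def A3_def A4_def WIF1_def WIF2'_def W1'_def CT1'_def
      equation_def
    by (elim UnE UN_E insertE emptyE Pair_inject) (simp_all add: wct_le_closed_comm A2 A3 A4 WIF1 WIF2' W1' CT1')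
qed

lemma WCT_axioms_sound: "WCT_axioms \<turnstile> t \<preceq> u \<Longrightarrow> t \<lesssim>\<^sub>W\<^sub>C\<^sub>T u"
proof (induction rule: derivable.induct)
  case (trans t u v)
  then show ?case
    unfolding wct_le_def using wct_le_closed_trans by blast
next
  case (instance_of t u \<sigma>)
  then show ?case
    by (simp add: wct_le_def subst_subst closed_subst_def closed_trm_subst)
next
  case (refl t)
  show ?case
    by (simp add: wct_le_def wct_le_closed_def)
qed (simp_all add: wct_le_def WCT_axioms_valid wct_le_closed_prefix
    wct_le_closed_sum_left wct_le_closed_sum_right)

section \<open>Derived inequations\<close>

abbreviation below :: "'a trm \<Rightarrow> 'a trm \<Rightarrow> bool" (infix "\<sqsubseteq>" 50) where
  "t \<sqsubseteq> u \<equiv> WCT_axioms \<turnstile> t \<preceq> u"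

definition equiv_trm :: "'a trm \<Rightarrow> 'a trm \<Rightarrow> bool" (infix "\<doteq>" 50) where
  "t \<doteq> u \<longleftrightarrow> t \<sqsubseteq> u \<and> u \<sqsubseteq> t"

lemmas below_trans [trans] = derivable.trans[where E = WCT_axioms]

lemma equiv_below [trans]: "t \<doteq> u \<Longrightarrow> u \<sqsubseteq> v \<Longrightarrow> t \<sqsubseteq> v"
  and below_equiv [trans]: "t \<sqsubseteq> u \<Longrightarrow> u \<doteq> v \<Longrightarrow> t \<sqsubseteq> v"
  and equiv_trans [trans]: "t \<doteq> u \<Longrightarrow> u \<doteq> v \<Longrightarrow> t \<doteq> v"
  by (auto simp: equiv_trm_def intro: derivable.trans)

lemma equiv_refl: "t \<doteq> t"
  by (simp add: equiv_trm_def derivable.refl)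

lemma equiv_sym: "t \<doteq> u \<Longrightarrow> u \<doteq> t"
  by (simp add: equiv_trm_def)

lemma below_sum: "t \<sqsubseteq> t' \<Longrightarrow> u \<sqsubseteq> u' \<Longrightarrow> t \<oplus> u \<sqsubseteq> t' \<oplus> u'"
  by (blast intro: derivable.trans derivable.sum_left derivable.sum_right)

lemma equiv_sum: "t \<doteq> t' \<Longrightarrow> u \<doteq> u' \<Longrightarrow> t \<oplus> u \<doteq> t' \<oplus> u'"
  by (simp add: equiv_trm_def below_sum)

lemma equiv_prefix: "t \<doteq> u \<Longrightarrow> \<alpha> \<cdot> t \<doteq> \<alpha> \<cdot> u"
  by (simp add: equiv_trm_def derivable.prefix)

lemma below_prefixes: "t \<sqsubseteq> u \<Longrightarrow> foldr (\<cdot>) p t \<sqsubseteq> foldr (\<cdot>) p u"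
  by (induction p) (auto intro: derivable.prefix)

lemma equiv_prefixes: "t \<doteq> u \<Longrightarrow> foldr (\<cdot>) p t \<doteq> foldr (\<cdot>) p u"
  by (simp add: equiv_trm_def below_prefixes)

text \<open>The axioms are stated over the variables 0, 1 and 2, which receive \<open>x\<close>,
  \<open>y\<close> and \<open>z\<close>.\<close>

lemma axiom_instance:
  assumes "(t, u) \<in> WCT_axioms"
  shows "subst (\<lambda>n. if n = 0 then x else if n = 1 then y else z) t
      \<sqsubseteq> subst (\<lambda>n. if n = 0 then x else if n = 1 then y else z) u"
  using assms by (intro derivable.instance_of derivable.ax)

section \<open>Instances of the axioms and rearrangement of sums\<close>

lemma sum_comm: "x \<oplus> y \<doteq> y \<oplus> x"
  using axiom_instance[of "x\<^sub>0 \<oplus> y\<^sub>0" "y\<^sub>0 \<oplus> x\<^sub>0" x y] axiom_instance[of "y\<^sub>0 \<oplus> x\<^sub>0" "x\<^sub>0 \<oplus> y\<^sub>0" x y]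
  by (simp add: equiv_trm_def WCT_axioms_def A1_def equation_def)

lemma sum_assoc: "(x \<oplus> y) \<oplus> z \<doteq> x \<oplus> (y \<oplus> z)"
  using axiom_instance[of "(x\<^sub>0 \<oplus> y\<^sub>0) \<oplus> z\<^sub>0" "x\<^sub>0 \<oplus> (y\<^sub>0 \<oplus> z\<^sub>0)" x y z]
    axiom_instance[of "x\<^sub>0 \<oplus> (y\<^sub>0 \<oplus> z\<^sub>0)" "(x\<^sub>0 \<oplus> y\<^sub>0) \<oplus> z\<^sub>0" x y z]
  by (simp add: equiv_trm_def WCT_axioms_def A2_def equation_def)

lemma sum_idem: "x \<oplus> x \<doteq> x"
  using axiom_instance[of "x\<^sub>0 \<oplus> x\<^sub>0" "x\<^sub>0" x] axiom_instance[of "x\<^sub>0" "x\<^sub>0 \<oplus> x\<^sub>0" x]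
  by (simp add: equiv_trm_def WCT_axioms_def A3_def equation_def)

lemma sum_zero: "x \<oplus> \<zero> \<doteq> x"
  using axiom_instance[of "x\<^sub>0 \<oplus> \<zero>" "x\<^sub>0" x] axiom_instance[of "x\<^sub>0" "x\<^sub>0 \<oplus> \<zero>" x]
  by (simp add: equiv_trm_def WCT_axioms_def A4_def equation_def)

lemma prefix_tau_sum: "\<alpha> \<cdot> (\<tau> \<cdot> x \<oplus> \<tau> \<cdot> y) \<doteq> \<alpha> \<cdot> x \<oplus> \<alpha> \<cdot> y"
  using axiom_instance[of "\<alpha> \<cdot> (\<tau> \<cdot> x\<^sub>0 \<oplus> \<tau> \<cdot> y\<^sub>0)" "\<alpha> \<cdot> x\<^sub>0 \<oplus> \<alpha> \<cdot> y\<^sub>0" x y]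
    axiom_instance[of "\<alpha> \<cdot> x\<^sub>0 \<oplus> \<alpha> \<cdot> y\<^sub>0" "\<alpha> \<cdot> (\<tau> \<cdot> x\<^sub>0 \<oplus> \<tau> \<cdot> y\<^sub>0)" x y]
  by (auto simp: equiv_trm_def WCT_axioms_def WIF1_def equation_def)

lemma tau_sum_below: "\<tau> \<cdot> (x \<oplus> y) \<sqsubseteq> \<tau> \<cdot> x \<oplus> y"
  using axiom_instance[of "\<tau> \<cdot> (x\<^sub>0 \<oplus> y\<^sub>0)" "\<tau> \<cdot> x\<^sub>0 \<oplus> y\<^sub>0" x y]
  by (simp add: WCT_axioms_def WIF2'_def)

lemma below_tau_sum: "x \<sqsubseteq> \<tau> \<cdot> x \<oplus> y"
  using axiom_instance[of "x\<^sub>0" "\<tau> \<cdot> x\<^sub>0 \<oplus> y\<^sub>0" x y]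
  by (simp add: WCT_axioms_def W1'_def)

lemma prefix_below_sum: "\<alpha> \<cdot> x \<sqsubseteq> \<alpha> \<cdot> x \<oplus> y"
  using axiom_instance[of "\<alpha> \<cdot> x\<^sub>0" "\<alpha> \<cdot> x\<^sub>0 \<oplus> y\<^sub>0" x y]
  by (auto simp: WCT_axioms_def CT1'_def)

lemma below_tau: "x \<sqsubseteq> \<tau> \<cdot> x"
  using below_tau_sum sum_zero by (rule below_equiv)

lemma zero_sum: "\<zero> \<oplus> x \<doteq> x"
  using sum_comm sum_zero by (rule equiv_trans)

lemma sum_left_comm: "x \<oplus> (y \<oplus> z) \<doteq> y \<oplus> (x \<oplus> z)"
  by (rule equiv_trans[OF equiv_sym[OF sum_assoc]
        equiv_trans[OF equiv_sum[OF sum_comm equiv_refl] sum_assoc]])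

lemma sum_right_comm: "(x \<oplus> y) \<oplus> z \<doteq> (x \<oplus> z) \<oplus> y"
  by (rule equiv_trans[OF sum_assoc
        equiv_trans[OF equiv_sum[OF equiv_refl sum_comm] equiv_sym[OF sum_assoc]]])

lemma sum_swap: "(x \<oplus> y) \<oplus> (z \<oplus> w) \<doteq> (x \<oplus> z) \<oplus> (y \<oplus> w)"
  by (rule equiv_trans[OF sum_assoc
        equiv_trans[OF equiv_sum[OF equiv_refl sum_left_comm] equiv_sym[OF sum_assoc]]])

lemma sum_below: "x \<sqsubseteq> z \<Longrightarrow> y \<sqsubseteq> z \<Longrightarrow> x \<oplus> y \<sqsubseteq> z"
  using below_sum sum_idem by (rule below_equiv)

section \<open>Absorption of silent prefixes and distribution of prefixes over sums\<close>

lemma prefix_tau_absorb: "\<alpha> \<cdot> \<tau> \<cdot> x \<doteq> \<alpha> \<cdot> x"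
proof -
  have "\<alpha> \<cdot> \<tau> \<cdot> x \<doteq> \<alpha> \<cdot> (\<tau> \<cdot> x \<oplus> \<tau> \<cdot> x)"
    by (rule equiv_prefix[OF equiv_sym[OF sum_idem]])
  also have "\<dots> \<doteq> \<alpha> \<cdot> x \<oplus> \<alpha> \<cdot> x"
    by (rule prefix_tau_sum)
  also have "\<dots> \<doteq> \<alpha> \<cdot> x"
    by (rule sum_idem)
  finally show ?thesis .
qed

text \<open>The innermost prefix of \<open>p\<close> does the absorbing, hence the split at the last
  element.\<close>

lemma prefixes_tau_absorb: "p \<noteq> [] \<Longrightarrow> foldr (\<cdot>) p (\<tau> \<cdot> x) \<doteq> foldr (\<cdot>) p x"
proof (induction p rule: rev_induct)
  case (snoc \<alpha> p)
  show ?case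
    using equiv_prefixes[OF prefix_tau_absorb] by simp
qed simp

text \<open>W1' puts \<open>\<tau>\<close> before both summands, and WIF1 then moves the sum
  outwards through one prefix of \<open>p\<close> after another, until it stands at the root, where
  \<open>sum_below\<close> bounds it.\<close>

lemma prefixes_sum:
  assumes "p \<noteq> []" "foldr (\<cdot>) p x \<sqsubseteq> z" "foldr (\<cdot>) p y \<sqsubseteq> z"
  shows "foldr (\<cdot>) p (x \<oplus> y) \<sqsubseteq> z"
proof -
  have distrib: "foldr (\<cdot>) p (\<tau> \<cdot> x \<oplus> \<tau> \<cdot> y) \<sqsubseteq> foldr (\<cdot>) p x \<oplus> foldr (\<cdot>) p y"
    using assms(1)
  proof (induction p)
    case (Cons \<alpha> p)
    show ?case
    proof (cases "p = []")
      case True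
      then show ?thesis
        using prefix_tau_sum by (auto simp: equiv_trm_def)
    next
      case False
      have "\<alpha> \<cdot> foldr (\<cdot>) p (\<tau> \<cdot> x \<oplus> \<tau> \<cdot> y) \<sqsubseteq> \<alpha> \<cdot> (foldr (\<cdot>) p x \<oplus> foldr (\<cdot>) p y)"
        using Cons.IH[OF False] by (rule derivable.prefix)
      \<comment> \<open>W1' restores the \<open>\<tau>\<close> that WIF1 needs at the next prefix
        outwards.\<close>
      also have "\<dots> \<sqsubseteq> \<alpha> \<cdot> (\<tau> \<cdot> foldr (\<cdot>) p x \<oplus> \<tau> \<cdot> foldr (\<cdot>) p y)"
        by (intro derivable.prefix below_sum below_tau)
      also have "\<dots> \<doteq> \<alpha> \<cdot> foldr (\<cdot>) p x \<oplus> \<alpha> \<cdot> foldr (\<cdot>) p y"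
        by (rule prefix_tau_sum)
      finally show ?thesis
        by simp
    qed
  qed simp
  have "foldr (\<cdot>) p (x \<oplus> y) \<sqsubseteq> foldr (\<cdot>) p (\<tau> \<cdot> x \<oplus> \<tau> \<cdot> y)"
    by (intro below_prefixes below_sum below_tau)
  also note distrib
  also have "foldr (\<cdot>) p x \<oplus> foldr (\<cdot>) p y \<sqsubseteq> z"
    using assms(2,3) by (rule sum_below)
  finally show ?thesis .
qed

text \<open>CT1' applies to a prefixed summand of \<open>x\<close>, and A1 and A2 bring the new
  summand to the outside.\<close>

lemma guarded_below_sum: "initials x \<noteq> {} \<Longrightarrow> x \<sqsubseteq> x \<oplus> y"
proof (induction x)
  case (Prefix \<alpha> x)
  show ?case
    by (rule prefix_below_sum)
next
  case (Sum u v)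
  show ?case
  proof (cases "initials v = {}")
    case True
    then have "u \<sqsubseteq> u \<oplus> y"
      using Sum by auto
    then have "u \<oplus> v \<sqsubseteq> (u \<oplus> y) \<oplus> v"
      by (rule derivable.sum_left)
    also have "\<dots> \<doteq> (u \<oplus> v) \<oplus> y"
      by (rule sum_right_comm)
    finally show ?thesis .
  next
    case False
    then have "u \<oplus> v \<sqsubseteq> u \<oplus> (v \<oplus> y)"
      using Sum by (auto intro: derivable.sum_right)
    also have "\<dots> \<doteq> (u \<oplus> v) \<oplus> y"
      by (rule equiv_sym[OF sum_assoc])
    finally show ?thesis .
  qed
qed auto

section \<open>Transitions turned into derivable inequations\<close>

lemma step_sum_absorb: "step u \<alpha> u' \<Longrightarrow> u \<oplus> \<alpha> \<cdot> u' \<doteq> u"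
proof (induction rule: step.induct)
  case (step_prefix \<alpha> t)
  show ?case
    by (rule sum_idem)
next
  case (step_sum_left t \<alpha> t' u)
  have "(t \<oplus> u) \<oplus> \<alpha> \<cdot> t' \<doteq> (t \<oplus> \<alpha> \<cdot> t') \<oplus> u"
    by (rule sum_right_comm)
  also have "\<dots> \<doteq> t \<oplus> u"
    by (rule equiv_sum[OF step_sum_left.IH equiv_refl])
  finally show ?case .
next
  case (step_sum_right t \<alpha> t' u)
  then show ?case
    using equiv_trans[OF sum_assoc] equiv_sum[OF equiv_refl] by blast
qed

lemma step_below: "step u \<alpha> u' \<Longrightarrow> \<alpha> \<cdot> u' \<sqsubseteq> u"
  using prefix_below_sum equiv_trans[OF sum_comm step_sum_absorb] by (rule below_equiv)

text \<open>Once a summand \<open>\<tau> \<cdot> u'\<close> of \<open>u\<close> is made explicit,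
  WIF2' leaves the outer \<open>\<tau>\<close> on that summand alone, where it is absorbed.\<close>

lemma tau_below: "\<tau> \<in> initials u \<Longrightarrow> \<tau> \<cdot> u \<sqsubseteq> u"
proof -
  assume "\<tau> \<in> initials u"
  then obtain u' where u': "step u \<tau> u'"
    by (auto simp: initials_def)
  have *: "\<tau> \<cdot> u' \<oplus> u \<doteq> u"
    using equiv_trans[OF sum_comm step_sum_absorb[OF u']] .
  then have "\<tau> \<cdot> u \<doteq> \<tau> \<cdot> (\<tau> \<cdot> u' \<oplus> u)"
    by (rule equiv_prefix[OF equiv_sym])
  also have "\<dots> \<sqsubseteq> \<tau> \<cdot> \<tau> \<cdot> u' \<oplus> u"
    by (rule tau_sum_below)
  also have "\<dots> \<doteq> \<tau> \<cdot> u' \<oplus> u"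
    by (intro equiv_sum prefix_tau_absorb equiv_refl)
  also note *
  finally show ?thesis .
qed

text \<open>The two claims are proved together: at a visible step \<open>\<tau>\<close> is inserted
  after the action, and the first claim handles the rest of the word.\<close>

lemma weak_steps_below:
  assumes "weak_steps w u u'"
  shows "\<tau> \<cdot> foldr (\<cdot>) (map Act w) u' \<sqsubseteq> \<tau> \<cdot> u"
    and "w \<noteq> [] \<Longrightarrow> foldr (\<cdot>) (map Act w) u' \<sqsubseteq> u"
  using assms
proof (induction rule: weak_steps_induct)
  case (refl t)
  {
    case 1
    show ?case
      by (simp add: derivable.refl)
  next
    case 2
    then show ?case
      by simp
  }
next
  case (tau w t t' u)
  have "\<tau> \<cdot> t' \<sqsubseteq> t"
    using tau.hyps(1) by (rule step_below)
  {
    case 1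
    note tau.IH(1)
    also note \<open>\<tau> \<cdot> t' \<sqsubseteq> t\<close>
    also note below_tau
    finally show ?case .
  next
    case 2
    note tau.IH(2)[OF 2]
    also note below_tau
    also note \<open>\<tau> \<cdot> t' \<sqsubseteq> t\<close>
    finally show ?case .
  }
next
  case (act a w t t' u)
  have *: "foldr (\<cdot>) (map Act (a # w)) u \<sqsubseteq> t"
  proof -
    have "foldr (\<cdot>) (map Act (a # w)) u \<doteq> Act a \<cdot> \<tau> \<cdot> foldr (\<cdot>) (map Act w) u"
      using equiv_sym[OF prefix_tau_absorb] by simp
    also have "\<dots> \<sqsubseteq> Act a \<cdot> \<tau> \<cdot> t'"
      by (intro derivable.prefix act.IH)
    also have "\<dots> \<doteq> Act a \<cdot> t'"
      by (rule prefix_tau_absorb)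
    also have "\<dots> \<sqsubseteq> t"
      using act.hyps(1) by (rule step_below)
    finally show ?thesis .
  qed
  {
    case 1
    show ?case
      using * by (rule derivable.prefix)
  next
    case 2
    show ?case
      by (rule *)
  }
qed

section \<open>Variable part and prefix part of a term\<close>

primrec root_vars :: "'a trm \<Rightarrow> nat set" where
  "root_vars \<zero> = {}"
| "root_vars (Var x) = {x}"
| "root_vars (\<alpha> \<cdot> t) = {}"
| "root_vars (t \<oplus> u) = root_vars t \<union> root_vars u"

text \<open>Summands of the other kind become \<open>\<zero>\<close>, here and in
  \<open>prefix_part\<close>. Both parts thus keep the shape of the term, and
  \<open>decompose\<close> follows by structural induction.\<close>

primrec var_part :: "'a trm \<Rightarrow> 'a trm" where
  "var_part \<zero> = \<zero>"
| "var_part (Var x) = Var x"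
| "var_part (\<alpha> \<cdot> t) = \<zero>"
| "var_part (t \<oplus> u) = var_part t \<oplus> var_part u"

primrec prefix_part :: "'a trm \<Rightarrow> 'a trm" where
  "prefix_part \<zero> = \<zero>"
| "prefix_part (Var x) = \<zero>"
| "prefix_part (\<alpha> \<cdot> t) = \<alpha> \<cdot> t"
| "prefix_part (t \<oplus> u) = prefix_part t \<oplus> prefix_part u"

lemma initials_prefix_part [simp]: "initials (prefix_part t) = initials t"
  by (induction t) auto

lemma decompose: "t \<doteq> prefix_part t \<oplus> var_part t"
proof (induction t)
  case (Sum t u)
  have "t \<oplus> u \<doteq> (prefix_part t \<oplus> var_part t) \<oplus> (prefix_part u \<oplus> var_part u)"
    using Sum by (rule equiv_sum)
  also have "\<dots> \<doteq> (prefix_part t \<oplus> prefix_part u) \<oplus> (var_part t \<oplus> var_part u)"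
    by (rule sum_swap)
  finally show ?case
    by simp
qed (auto intro: equiv_sym[OF sum_zero] equiv_sym[OF zero_sum])

lemma prefix_part_stuck: "initials t = {} \<Longrightarrow> prefix_part t \<doteq> \<zero>"
proof (induction t)
  case (Sum t u)
  then have "prefix_part t \<oplus> prefix_part u \<doteq> \<zero> \<oplus> \<zero>"
    by (intro equiv_sum) auto
  also have "\<dots> \<doteq> \<zero>"
    by (rule sum_zero)
  finally show ?case
    by simp
qed (auto intro: equiv_refl)

lemma stuck_var_part: "initials t = {} \<Longrightarrow> t \<doteq> var_part t"
  by (rule equiv_trans[OF decompose
        equiv_trans[OF equiv_sum[OF prefix_part_stuck equiv_refl] zero_sum]])

lemma root_var_absorb: "x \<in> root_vars u \<Longrightarrow> u \<oplus> Var x \<doteq> u"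
proof (induction u)
  case (Var y)
  then show ?case
    by (simp add: sum_idem)
next
  case (Sum t u)
  show ?case
  proof (cases "x \<in> root_vars u")
    case True
    then show ?thesis
      using Sum equiv_trans[OF sum_assoc] equiv_sum[OF equiv_refl] by blast
  next
    case False
    have "(t \<oplus> u) \<oplus> Var x \<doteq> (t \<oplus> Var x) \<oplus> u"
      by (rule sum_right_comm)
    also have "\<dots> \<doteq> t \<oplus> u"
      using False Sum by (auto intro: equiv_sum equiv_refl)
    finally show ?thesis .
  qed
qed auto

lemma var_part_absorb: "root_vars t \<subseteq> root_vars u \<Longrightarrow> u \<oplus> var_part t \<doteq> u"
proof (induction t)
  case (Sum t1 t2)
  have "u \<oplus> (var_part t1 \<oplus> var_part t2) \<doteq> (u \<oplus> var_part t1) \<oplus> var_part t2"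
    by (rule equiv_sym[OF sum_assoc])
  also have "\<dots> \<doteq> u \<oplus> var_part t2"
    using Sum by (auto intro: equiv_sum equiv_refl)
  also have "\<dots> \<doteq> u"
    using Sum by auto
  finally show ?case
    by simp
qed (auto intro: sum_zero root_var_absorb)

text \<open>The prefixed summands are bounded one by one and joined by \<open>sum_below\<close> or
  \<open>prefixes_sum\<close>. What a stuck summand leaves is removed beforehand, since
  \<open>\<zero>\<close> under \<open>p\<close> need not be below \<open>z\<close>.\<close>

lemma prefix_part_below:
  assumes "\<And>\<alpha> t'. step t \<alpha> t' \<Longrightarrow> foldr (\<cdot>) p (\<alpha> \<cdot> t') \<sqsubseteq> z" "initials t \<noteq> {}"
  shows "foldr (\<cdot>) p (prefix_part t) \<sqsubseteq> z"
  using assms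
proof (induction t)
  case (Sum t u)
  consider "initials t = {}" | "initials u = {}" | "initials t \<noteq> {}" "initials u \<noteq> {}"
    by blast
  then show ?case
  proof cases
    case 1
    then have "prefix_part t \<oplus> prefix_part u \<doteq> prefix_part u"
      by (intro equiv_trans[OF equiv_sum[OF prefix_part_stuck equiv_refl] zero_sum])
    then have "foldr (\<cdot>) p (prefix_part (t \<oplus> u)) \<doteq> foldr (\<cdot>) p (prefix_part u)"
      using equiv_prefixes by simp
    also have "\<dots> \<sqsubseteq> z"
      using 1 Sum by auto
    finally show ?thesis .
  next
    case 2
    then have "prefix_part t \<oplus> prefix_part u \<doteq> prefix_part t"
      by (intro equiv_trans[OF equiv_sum[OF equiv_refl prefix_part_stuck] sum_zero])
    then have "foldr (\<cdot>) p (prefix_part (t \<oplus> u)) \<doteq> foldr (\<cdot>) p (prefix_part t)"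
      using equiv_prefixes by simp
    also have "\<dots> \<sqsubseteq> z"
      using 2 Sum by auto
    finally show ?thesis .
  next
    case 3
    then have "foldr (\<cdot>) p (prefix_part t) \<sqsubseteq> z" "foldr (\<cdot>) p (prefix_part u) \<sqsubseteq> z"
      using Sum by auto
    then show ?thesis
      by (cases "p = []") (auto intro: sum_below prefixes_sum)
  qed
qed auto

text \<open>
  The guard \<open>g\<close> is essential: it lets each variable \<open>x\<close> be enlarged, by CT1', to a state \<open>u'\<close>
  that contains it. Without it \<open>x = \<zero>\<close> would terminate where \<open>u'\<close> need not.
\<close>

lemma guarded_var_part_below:
  assumes "p \<noteq> []" "initials g \<noteq> {}" "foldr (\<cdot>) p g \<sqsubseteq> z"
    and "\<And>x. x \<in> root_vars t \<Longrightarrow> \<exists>u'. x \<in> root_vars u' \<and> foldr (\<cdot>) p u' \<sqsubseteq> z"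
  shows "foldr (\<cdot>) p (g \<oplus> var_part t) \<sqsubseteq> z"
  using assms(2-4)
proof (induction t arbitrary: g)
  case (Var x)
  then obtain u' where u': "x \<in> root_vars u'" "foldr (\<cdot>) p u' \<sqsubseteq> z"
    by auto
  have "g \<oplus> Var x \<sqsubseteq> (g \<oplus> u') \<oplus> Var x"
    using Var.prems(1) by (intro derivable.sum_left guarded_below_sum)
  also have "\<dots> \<doteq> g \<oplus> (u' \<oplus> Var x)"
    by (rule sum_assoc)
  also have "\<dots> \<doteq> g \<oplus> u'"
    using u'(1) by (intro equiv_sum equiv_refl root_var_absorb)
  finally have "foldr (\<cdot>) p (g \<oplus> Var x) \<sqsubseteq> foldr (\<cdot>) p (g \<oplus> u')"
    by (rule below_prefixes)
  also have "\<dots> \<sqsubseteq> z"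
    using assms(1) Var.prems(2) u'(2) by (rule prefixes_sum)
  finally show ?case
    by simp
next
  case (Sum t1 t2)
  \<comment> \<open>The guard grows: once the variables of \<open>t1\<close> are added,
    \<open>g \<oplus> var_part t1\<close> is the guard for those of \<open>t2\<close>.\<close>
  have "foldr (\<cdot>) p (g \<oplus> (var_part t1 \<oplus> var_part t2))
      \<doteq> foldr (\<cdot>) p ((g \<oplus> var_part t1) \<oplus> var_part t2)"
    by (intro equiv_prefixes equiv_sym[OF sum_assoc])
  also have "\<dots> \<sqsubseteq> z"
    using Sum by auto
  finally show ?case
    by simp
qed (simp_all add: equiv_below[OF equiv_prefixes[OF sum_zero]])

section \<open>Completeness\<close>

text \<open>
  The inclusion of variables is reversed for stuck states: under a substitution such a state
  terminates iff all its variables become stuck, so fewer variables mean more traces.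
\<close>

definition matched :: "'a list \<Rightarrow> 'a trm \<Rightarrow> 'a trm \<Rightarrow> bool" where
  "matched w t u \<longleftrightarrow>
     (\<forall>v t'. weak_steps v t t' \<longrightarrow>
        (\<forall>x \<in> root_vars t'. \<exists>u'. weak_steps (w @ v) u u' \<and> x \<in> root_vars u') \<and>
        (initials t' = {} \<longrightarrow>
          (\<exists>u'. weak_steps (w @ v) u u' \<and> initials u' = {} \<and> root_vars u' \<subseteq> root_vars t')))"

lemma matched_var:
  "matched w t u \<Longrightarrow> x \<in> root_vars t \<Longrightarrow> \<exists>u'. weak_steps w u u' \<and> x \<in> root_vars u'"
  unfolding matched_def using weak_steps_refl by (metis append_Nil2)

lemma matched_stuck:
  "matched w t u \<Longrightarrow> initials t = {} \<Longrightarrow>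
     \<exists>u'. weak_steps w u u' \<and> initials u' = {} \<and> root_vars u' \<subseteq> root_vars t"
  unfolding matched_def using weak_steps_refl by (metis append_Nil2)

lemma matched_tau: "matched w t u \<Longrightarrow> step t \<tau> t' \<Longrightarrow> matched w t' u"
  unfolding matched_def using weak_steps_tau by blast

text \<open>The word \<open>w\<close> records the visible actions performed on the way to
  \<open>t\<close>, while \<open>u\<close> remains the original term and has to perform the whole
  word.\<close>

lemma matched_act: "matched w t u \<Longrightarrow> step t (Act a) t' \<Longrightarrow> matched (w @ [a]) t' u"
  unfolding matched_def by (auto dest: weak_steps_act simp del: weak_steps.simps)

text \<open>The context \<open>p\<close> stands for the way to \<open>t\<close>, and
  \<open>z\<close> bounds all states that \<open>u\<close> reaches by extensions of
  \<open>w\<close>. A stuck \<open>t\<close> is compared with a stuck state of \<open>u\<close>; any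
  other \<open>t\<close> is split into its prefixed summands, bounded by induction, and its
  variables, added under their guard.\<close>

lemma matched_below:
  assumes "p \<noteq> []" "matched w t u"
    and "\<And>v u'. weak_steps (w @ v) u u' \<Longrightarrow> foldr (\<cdot>) p (foldr (\<cdot>) (map Act v) u') \<sqsubseteq> z"
  shows "foldr (\<cdot>) p t \<sqsubseteq> z"
  using assms
proof (induction t arbitrary: p w rule: measure_induct_rule [of size])
  case (less t)
  have bound: "foldr (\<cdot>) p u' \<sqsubseteq> z" if "weak_steps w u u'" for u'
    using less.prems(3)[of "[]" u'] that by simp
  have vars: "\<exists>u'. x \<in> root_vars u' \<and> foldr (\<cdot>) p u' \<sqsubseteq> z" if "x \<in> root_vars t" for x
    using matched_var[OF less.prems(2) that] bound by blast
  show ?case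
  proof (cases "initials t = {}")
    case True
    then obtain u' where u': "weak_steps w u u'" "initials u' = {}" "root_vars u' \<subseteq> root_vars t"
      using matched_stuck less.prems(2) by blast
    \<comment> \<open>Both terms are essentially sums of variables and those of \<open>u'\<close>
      occur in \<open>t\<close>, so \<open>u'\<close> can be split off from \<open>t\<close>. Being
      stuck, \<open>u'\<close> is no guard; WIF2' turns it into the guard
      \<open>\<tau> \<cdot> u'\<close>.\<close>
    have "t \<doteq> t \<oplus> var_part u'"
      using u'(3) by (intro equiv_sym[OF var_part_absorb])
    also have "\<dots> \<doteq> var_part u' \<oplus> t"
      by (rule sum_comm)
    also have "\<dots> \<doteq> u' \<oplus> var_part t"
      using True u'(2) by (intro equiv_sum stuck_var_part equiv_sym[OF stuck_var_part])
    finally have "\<tau> \<cdot> t \<doteq> \<tau> \<cdot> (u' \<oplus> var_part t)"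
      by (rule equiv_prefix)
    also have "\<dots> \<sqsubseteq> \<tau> \<cdot> u' \<oplus> var_part t"
      by (rule tau_sum_below)
    finally have le: "\<tau> \<cdot> t \<sqsubseteq> \<tau> \<cdot> u' \<oplus> var_part t" .
    \<comment> \<open>Below the nonempty \<open>p\<close> a \<open>\<tau>\<close> may be inserted in
      front of \<open>t\<close>, and later dropped in front of \<open>u'\<close>.\<close>
    have "foldr (\<cdot>) p t \<doteq> foldr (\<cdot>) p (\<tau> \<cdot> t)"
      using less.prems(1) by (intro equiv_sym[OF prefixes_tau_absorb])
    also have "\<dots> \<sqsubseteq> foldr (\<cdot>) p (\<tau> \<cdot> u' \<oplus> var_part t)"
      using le by (rule below_prefixes)
    also have "\<dots> \<sqsubseteq> z"
      using less.prems(1) _ equiv_below[OF prefixes_tau_absorb[OF less.prems(1)] bound[OF u'(1)]] vars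
      by (rule guarded_var_part_below) auto
    finally show ?thesis .
  next
    case False
    have "foldr (\<cdot>) p (\<alpha> \<cdot> t') \<sqsubseteq> z" if t': "step t \<alpha> t'" for \<alpha> t'
    proof (cases \<alpha>)
      case Tau
      have "foldr (\<cdot>) p (\<tau> \<cdot> t') \<doteq> foldr (\<cdot>) p t'"
        using less.prems(1) by (rule prefixes_tau_absorb)
      also have "\<dots> \<sqsubseteq> z"
        using step_size[OF t'] less.prems(1) matched_tau[OF less.prems(2) t'[unfolded Tau]] less.prems(3)
        by (rule less.IH)
      finally show ?thesis
        by (simp add: Tau)
    next
      case (Act a)
      \<comment> \<open>A visible action moves from the term into both the context and the word; the
        bound for the longer word is the old one at \<open>a # v\<close>.\<close>
      have "foldr (\<cdot>) (p @ [Act a]) t' \<sqsubseteq> z"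
      proof (rule less.IH)
        show "foldr (\<cdot>) (p @ [Act a]) (foldr (\<cdot>) (map Act v) u') \<sqsubseteq> z"
          if "weak_steps ((w @ [a]) @ v) u u'" for v u'
          using less.prems(3)[of "a # v" u'] that by simp
      qed (use step_size[OF t'] matched_act[OF less.prems(2) t'[unfolded Act]] in auto)
      then show ?thesis
        by (simp add: Act)
    qed
    then have "foldr (\<cdot>) p (prefix_part t) \<sqsubseteq> z"
      using False by (rule prefix_part_below)
    then have "foldr (\<cdot>) p (prefix_part t \<oplus> var_part t) \<sqsubseteq> z"
      using less.prems(1) False vars by (intro guarded_var_part_below) auto
    then show ?thesis
      using equiv_below[OF equiv_prefixes[OF decompose]] by blast
  qed
qed

text \<open>\<open>matched_below\<close> works under a nonempty context, which is missing at the
  root. If \<open>u\<close> has a silent step, \<open>[\<tau>]\<close> serves, because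
  \<open>\<tau> \<cdot> u\<close> is below \<open>u\<close>. Otherwise the prefixes of
  \<open>t\<close> are visible and serve themselves, and the root variables of \<open>t\<close> are
  absorbed by \<open>u\<close>.\<close>

lemma matched_root_below:
  assumes "matched [] t u"
    and "\<tau> \<in> initials u \<or> \<tau> \<notin> initials t \<and> root_vars t \<subseteq> root_vars u"
  shows "t \<sqsubseteq> u"
proof (cases "\<tau> \<in> initials u")
  case True
  note below_tau
  also have "\<tau> \<cdot> t \<sqsubseteq> \<tau> \<cdot> u"
    using matched_below[of "[\<tau>]" "[]" t u "\<tau> \<cdot> u"] assms(1)
    by (simp add: weak_steps_below(1))
  also have "\<dots> \<sqsubseteq> u"
    using True by (rule tau_below)
  finally show ?thesis .
next
  case False
  show ?thesis
  proof (cases "initials t = {}")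
    case True
    then obtain u' where u': "weak_steps [] u u'" "initials u' = {}" "root_vars u' \<subseteq> root_vars t"
      using matched_stuck assms(1) by blast
    \<comment> \<open>Without silent steps \<open>u\<close> reaches only itself by the empty word,
      so it is stuck as well and has the same root variables as \<open>t\<close>.\<close>
    have "u' = u"
      using u'(1) False by (auto simp: tau_steps_def elim: converse_rtranclpE dest: step_initials)
    have "t \<doteq> t \<oplus> var_part u"
      using u' \<open>u' = u\<close> by (intro equiv_sym[OF var_part_absorb]) auto
    also have "\<dots> \<doteq> var_part t \<oplus> u"
      using True u' \<open>u' = u\<close> by (intro equiv_sum stuck_var_part equiv_sym[OF stuck_var_part]) auto
    also have "\<dots> \<doteq> u \<oplus> var_part t"
      by (rule sum_comm)
    also have "\<dots> \<doteq> u"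
      using assms(2) False by (intro var_part_absorb) auto
    finally show ?thesis
      by (simp add: equiv_trm_def)
  next
    case nonempty: False
    have "\<alpha> \<cdot> t' \<sqsubseteq> u" if t': "step t \<alpha> t'" for \<alpha> t'
    proof -
      obtain a where a: "\<alpha> = Act a"
        using assms(2) False step_initials[OF t'] by (cases \<alpha>) auto
      have "foldr (\<cdot>) [Act a] t' \<sqsubseteq> u"
      proof (rule matched_below)
        show "matched [a] t' u"
          using matched_act[OF assms(1) t'[unfolded a]] by simp
        show "foldr (\<cdot>) [Act a] (foldr (\<cdot>) (map Act v) u') \<sqsubseteq> u" if "weak_steps ([a] @ v) u u'" for v u'
          using weak_steps_below(2)[OF that] by simp
      qed simp
      then show ?thesis
        by (simp add: a)
    qed
    then have "prefix_part t \<sqsubseteq> u"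
      using prefix_part_below[of t "[]" u] nonempty by simp
    then have "prefix_part t \<oplus> var_part t \<sqsubseteq> u \<oplus> var_part t"
      by (rule derivable.sum_left)
    also have "\<dots> \<doteq> u"
      using assms(2) False by (intro var_part_absorb) auto
    finally show ?thesis
      using equiv_below[OF decompose] by blast
  qed
qed

section \<open>Traces of closed instances\<close>

lemma step_subst:
  "step (subst \<sigma> t) \<alpha> s \<longleftrightarrow>
     (\<exists>t'. step t \<alpha> t' \<and> s = subst \<sigma> t') \<or> (\<exists>x \<in> root_vars t. step (\<sigma> x) \<alpha> s)"
  by (induction t) auto

lemma initials_subst: "initials (subst \<sigma> t) = initials t \<union> (\<Union>x \<in> root_vars t. initials (\<sigma> x))"
  by (induction t) auto

lemma weak_steps_subst: "weak_steps w t t' \<Longrightarrow> weak_steps w (subst \<sigma> t) (subst \<sigma> t')"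
  by (induction rule: weak_steps_induct)
    (meson step_subst weak_steps_refl weak_steps_tau weak_steps_act)+

text \<open>The term \<open>\<sigma> x\<close> has to be able to move: the empty trace of a stuck
  summand says nothing about the other summands of \<open>subst \<sigma> t'\<close>.\<close>

lemma WCT_subst_var:
  assumes "weak_steps v t t'" "x \<in> root_vars t'" "w \<in> WCT (\<sigma> x)" "initials (\<sigma> x) \<noteq> {}"
  shows "v @ w \<in> WCT (subst \<sigma> t)"
proof -
  have "w \<in> WCT (subst \<sigma> t')"
    using assms(3,4) by (rule WCT_mono_steps) (use assms(2) in \<open>auto simp: step_subst\<close>)
  then show ?thesis
    using weak_steps_subst[OF assms(1)] WCT_weak_steps by blast
qed

lemma WCT_subst_stuck:
  assumes "weak_steps v t t'" "initials t' = {}" "\<And>x. x \<in> root_vars t' \<Longrightarrow> initials (\<sigma> x) = {}"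
  shows "v \<in> WCT (subst \<sigma> t)"
proof -
  have "initials (subst \<sigma> t') = {}"
    using assms(2,3) by (simp add: initials_subst)
  then show ?thesis
    unfolding WCT_def using weak_steps_subst[OF assms(1)] by blast
qed

text \<open>A completed run of an instance follows \<open>t\<close> until either a substituted term
  takes over with a step of its own, or the run ends in a state of \<open>t\<close> that is stuck
  together with all its variables.\<close>

lemma WCT_subst_cases:
  assumes "w \<in> WCT (subst \<sigma> t)"
  obtains (var) v t' x w' where "weak_steps v t t'" "x \<in> root_vars t'" "w = v @ w'"
      "w' \<in> WCT (\<sigma> x)" "initials (\<sigma> x) \<noteq> {}"
  | (stuck) t' where "weak_steps w t t'" "initials t' = {}"
      "\<And>x. x \<in> root_vars t' \<Longrightarrow> initials (\<sigma> x) = {}"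
proof -
  \<comment> \<open>The two cases as one predicate, closed under prepending a transition of
    \<open>t\<close>, so that it fits the induction.\<close>
  define Q where "Q w t \<longleftrightarrow>
      (\<exists>v t' x w'. weak_steps v t t' \<and> x \<in> root_vars t' \<and> w = v @ w' \<and> w' \<in> WCT (\<sigma> x)
        \<and> initials (\<sigma> x) \<noteq> {})
    \<or> (\<exists>t'. weak_steps w t t' \<and> initials t' = {} \<and> (\<forall>x \<in> root_vars t'. initials (\<sigma> x) = {}))" for w t
  have Q_var: "Q w t" if "x \<in> root_vars t" "w \<in> WCT (\<sigma> x)" "initials (\<sigma> x) \<noteq> {}" for w t x
    unfolding Q_def using that weak_steps_refl[of t] by (metis append_Nil)
  have Q_tau: "Q w t" if "step t \<tau> t'" "Q w t'" for w t t'
    using that weak_steps_tau unfolding Q_def by blast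
  have Q_act: "Q (a # w) t" if "step t (Act a) t'" "Q w t'" for a w t t'
    using that(2)[unfolded Q_def]
  proof (elim disjE exE conjE)
    fix v s x w'
    assume *: "weak_steps v t' s" "x \<in> root_vars s" "w = v @ w'" "w' \<in> WCT (\<sigma> x)" "initials (\<sigma> x) \<noteq> {}"
    have "weak_steps (a # v) t s" "a # w = (a # v) @ w'"
      using weak_steps_act[OF that(1) *(1)] *(3) by simp_all
    with *(2,4,5) show ?thesis
      unfolding Q_def by blast
  next
    fix s
    assume "weak_steps w t' s" "initials s = {}" "\<forall>x \<in> root_vars s. initials (\<sigma> x) = {}"
    then show ?thesis
      unfolding Q_def using weak_steps_act[OF that(1)] by blast
  qed
  have "Q w t"
    using assms
  proof (induction w "subst \<sigma> t" arbitrary: t rule: WCT_induct)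
    case stop
    then have "initials t = {} \<and> (\<forall>x \<in> root_vars t. initials (\<sigma> x) = {})"
      by (auto simp: initials_subst)
    then show ?case
      unfolding Q_def using weak_steps_refl by blast
  next
    case (tau w s)
    from tau.hyps(1) consider t' where "step t \<tau> t'" "s = subst \<sigma> t'"
      | x where "x \<in> root_vars t" "step (\<sigma> x) \<tau> s"
      by (auto simp: step_subst)
    then show ?case
    proof cases
      case 1
      with tau show ?thesis
        by (auto intro: Q_tau)
    next
      \<comment> \<open>The substituted term makes the first move, so all of \<open>w\<close> is a
        trace of \<open>\<sigma> x\<close> and \<open>t\<close> contributes the empty word.\<close>
      case 2
      then show ?thesis
        using Q_var[OF 2(1) WCT_tau[OF 2(2) tau.hyps(2)]] step_initials by blast
    qed
  next
    case (act a w s)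
    from act.hyps(1) consider t' where "step t (Act a) t'" "s = subst \<sigma> t'"
      | x where "x \<in> root_vars t" "step (\<sigma> x) (Act a) s"
      by (auto simp: step_subst)
    then show ?case
    proof cases
      case 1
      with act show ?thesis
        by (auto intro: Q_act)
    next
      case 2
      then show ?thesis
        using Q_var[OF 2(1) WCT_act[OF 2(2) act.hyps(2)]] step_initials by blast
    qed
  qed
  then show thesis
    unfolding Q_def using that by blast
qed

section \<open>Substitutions that tell variables apart\<close>

lemma weak_steps_length: "weak_steps w t t' \<Longrightarrow> length w \<le> size t"
  by (induction rule: weak_steps_induct) (auto dest: step_size)

text \<open>Some fixed action is wanted, and \<open>undefined\<close> names one. A chain has a
  single completed trace, so its length is what identifies it.\<close>

definition chain :: "nat \<Rightarrow> 'a trm" where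
  "chain n = foldr (\<cdot>) (replicate n (Act undefined)) \<zero>"

lemma WCT_chain: "WCT (chain n) = {replicate n undefined}"
  unfolding chain_def by (induction n) (auto simp: WCT_stuck WCT_prefix_act)

lemma initials_chain: "0 < n \<Longrightarrow> initials (chain n) = {Act undefined}"
  by (cases n) (auto simp: chain_def)

lemma closed_chain: "closed_trm (chain n)"
  unfolding chain_def by (induction n) (auto simp: closed_trm_def)

lemma wct_le_WCT:
  "t \<lesssim>\<^sub>W\<^sub>C\<^sub>T u \<Longrightarrow> (\<And>x. closed_trm (\<sigma> x)) \<Longrightarrow> w \<in> WCT (subst \<sigma> t) \<Longrightarrow> w \<in> WCT (subst \<sigma> u)"
  by (auto simp: wct_le_def closed_subst_def wct_le_closed_def)

text \<open>Each half of \<open>matched\<close> is read off from one test substitution, in which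
  chains are so long that only the wanted kind of run of \<open>u\<close> can match the trace of
  \<open>t\<close>.\<close>

lemma wct_le_matched:
  assumes "t \<lesssim>\<^sub>W\<^sub>C\<^sub>T u"
  shows "matched [] t u"
  unfolding matched_def append_Nil
proof (intro allI impI conjI ballI)
  fix v t' x
  assume t': "weak_steps v t t'" "x \<in> root_vars t'"
  \<comment> \<open>By \<open>weak_steps_length\<close> the transitions of \<open>u\<close> alone
    give words of length at most \<open>size u\<close>, so a matching trace has to pass through
    \<open>x\<close>.\<close>
  define \<sigma> :: "nat \<Rightarrow> 'a trm" where "\<sigma> = (\<lambda>y. if y = x then chain (Suc (size u)) else \<zero>)"
  have "v @ replicate (Suc (size u)) undefined \<in> WCT (subst \<sigma> t)"
    using t' by (rule WCT_subst_var) (simp_all add: \<sigma>_def WCT_chain initials_chain del: replicate_Suc)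
  then have "v @ replicate (Suc (size u)) undefined \<in> WCT (subst \<sigma> u)"
    by (rule wct_le_WCT[OF assms, rotated]) (auto simp: \<sigma>_def closed_chain closed_trm_def[of \<zero>])
  then show "\<exists>u'. weak_steps v u u' \<and> x \<in> root_vars u'"
  proof (cases rule: WCT_subst_cases)
    case (var w u' y w')
    \<comment> \<open>Only \<open>x\<close> can move. Its single trace is a common suffix of both
      words, and cancelling it leaves \<open>w = v\<close>.\<close>
    then have "y = x"
      by (auto simp: \<sigma>_def split: if_splits)
    with var show ?thesis
      by (auto simp: \<sigma>_def WCT_chain simp del: replicate_Suc)
  next
    case (stuck u')
    then show ?thesis
      using weak_steps_length by fastforce
  qed
next
  fix v t'
  assume t': "weak_steps v t t'" "initials t' = {}"
  \<comment> \<open>With \<open>\<zero>\<close> for the variables of \<open>t'\<close> the word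
    \<open>v\<close> is completed. Any other variable yields a trace longer than \<open>v\<close>,
    so a run for \<open>v\<close> cannot pass through it.\<close>
  define \<sigma> :: "nat \<Rightarrow> 'a trm"
    where "\<sigma> = (\<lambda>y. if y \<in> root_vars t' then \<zero> else chain (Suc (length v)))"
  have "v \<in> WCT (subst \<sigma> t)"
    using t' by (rule WCT_subst_stuck) (simp add: \<sigma>_def)
  then have "v \<in> WCT (subst \<sigma> u)"
    by (rule wct_le_WCT[OF assms, rotated]) (auto simp: \<sigma>_def closed_chain closed_trm_def[of \<zero>])
  then show "\<exists>u'. weak_steps v u u' \<and> initials u' = {} \<and> root_vars u' \<subseteq> root_vars t'"
  proof (cases rule: WCT_subst_cases)
    case (var w u' y w')
    then have "w' = replicate (Suc (length v)) undefined"
      by (auto simp: \<sigma>_def WCT_chain simp del: replicate_Suc split: if_splits)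
    then have "length w' = Suc (length v)"
      by simp
    with var(3) show ?thesis
      by simp
  next
    case (stuck u')
    have "x \<in> root_vars t'" if "x \<in> root_vars u'" for x
      using stuck(3)[OF that] by (simp add: \<sigma>_def initials_chain split: if_splits)
    with stuck show ?thesis
      by blast
  qed
qed

text \<open>The clause on initial silent steps is tested with \<open>\<zero>\<close> for all
  variables, and then with \<open>\<tau> \<cdot> \<zero>\<close> for a single one.\<close>

lemma wct_le_root:
  assumes "t \<lesssim>\<^sub>W\<^sub>C\<^sub>T u"
  shows "\<tau> \<in> initials u \<or> \<tau> \<notin> initials t \<and> root_vars t \<subseteq> root_vars u"
proof -
  have le: "\<tau> \<in> initials (subst \<sigma> t) \<Longrightarrow> \<tau> \<in> initials (subst \<sigma> u)" if "\<And>x. closed_trm (\<sigma> x)" for \<sigma>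
    using assms that by (auto simp: wct_le_def closed_subst_def wct_le_closed_def)
  have "\<tau> \<in> initials u" if "\<tau> \<in> initials t"
    using le[of "\<lambda>_. \<zero>"] that by (simp add: initials_subst closed_trm_def)
  moreover have "\<tau> \<in> initials u \<or> x \<in> root_vars u" if "x \<in> root_vars t" for x
  proof -
    define \<sigma> :: "nat \<Rightarrow> 'a trm" where "\<sigma> = (\<lambda>y. if y = x then \<tau> \<cdot> \<zero> else \<zero>)"
    have \<sigma>: "\<tau> \<in> initials (\<sigma> y) \<longleftrightarrow> y = x" "closed_trm (\<sigma> y)" for y
      by (simp_all add: \<sigma>_def closed_trm_def)
    show ?thesis
      using le[of \<sigma>, OF \<sigma>(2)] that by (auto simp: initials_subst \<sigma>(1))
  qed
  ultimately show ?thesis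
    by blast
qed

lemma WCT_axioms_complete: "t \<lesssim>\<^sub>W\<^sub>C\<^sub>T u \<Longrightarrow> WCT_axioms \<turnstile> t \<preceq> u"
  by (intro matched_root_below wct_le_matched wct_le_root)

theorem theorem4p4:
  shows "sound (WCT_axioms :: ('a :: countable) ineq set) wct_le
       \<and> ground_complete (WCT_axioms :: 'a ineq set) wct_le
       \<and> omega_complete (WCT_axioms :: 'a ineq set)"
proof (intro conjI)
  show "sound (WCT_axioms :: 'a ineq set) wct_le"
    by (simp add: sound_def WCT_axioms_sound)
  show "ground_complete (WCT_axioms :: 'a ineq set) wct_le"
    by (simp add: ground_complete_def WCT_axioms_complete)
  show "omega_complete (WCT_axioms :: 'a ineq set)"
    unfolding omega_complete_def
  proof (intro allI impI)
    fix t u :: "'a trm"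
    assume *: "\<forall>\<sigma>. closed_subst \<sigma> \<longrightarrow> WCT_axioms \<turnstile> subst \<sigma> t \<preceq> subst \<sigma> u"
    \<comment> \<open>Soundness turns the derivable closed instances into valid ones, and
      completeness is already available for open terms.\<close>
    have "t \<lesssim>\<^sub>W\<^sub>C\<^sub>T u"
      unfolding wct_le_def
      using * WCT_axioms_sound wct_le_iff_closed closed_trm_subst by blast
    then show "WCT_axioms \<turnstile> t \<preceq> u"
      by (rule WCT_axioms_complete)
  qed
qed

end
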